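(* For every $f\in C$ the following properties are equivalent: 1. $f$ is a form of inertia of $f_1,\dots,f_r$, i.e. $f\in\mathcal{T}$. 2. There exists $\nu\in\mathbb{N}$ such that $\sigma_{i_1\dots i_s}^{\nu}f$ lies in the ideal $(f_1,\dots,f_r)$ of $C$ for all $(i_1,\dots,i_s)\in\prod_{j=1}^s\{1,\dots,n_j+1\}$. 3. There exist $\nu\in\mathbb{N}$ and $(i_1,\dots,i_s)\in\prod_{j=1}^s\{1,\dots,n_j+1\}$ such that $\sigma_{i_1\dots i_s}^{\nu}f\in(f_1,\dots,f_r)$. 4. There exist natural numbers $\nu_1,\dots,\nu_s$ such that for every $(\underline{\alpha}_1,\dots,\underline{\alpha}_s)\in\prod_{j=1}^s\mathbb{N}^{n_j+1}$ with $|\underline{\alpha}_j|=\nu_j$ for $1\le j\le s$, the polynomial $\underline{X}_1^{\underline{\alpha}_1}\cdots\underline{X}_s^{\underline{\alpha}_s}f$ lies in $(f_1,\dots,f_r)$.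
   Context: Let $K$ be a commutative integral domain, $s\ge 1$, and $n_s\ge n_{s-1}\ge\dots\ge n_1\ge 1$ integers. For $1\le j\le s$ let $\underline{X}_j=(X_{j,1},\dots,X_{j,n_j+1})$ be a packet of indeterminates; for $\underline{\alpha}_j=(\alpha_{j,1},\dots,\alpha_{j,n_j+1})\in\mathbb{N}^{n_j+1}$ put $|\underline{\alpha}_j|=\sum_l\alpha_{j,l}$ and $\underline{X}_j^{\underline{\alpha}_j}=X_{j,1}^{\alpha_{j,1}}\cdots X_{j,n_j+1}^{\alpha_{j,n_j+1}}$. Let $r\in\mathbb{N}$ and let $d_{i,j}\ge 1$ ($1\le i\le r$, $1\le j\le s$) be integers. Let $A=K[U_{i,\underline{\alpha}_1,\dots,\underline{\alpha}_s}]$ be the polynomial ring in indeterminates indexed by $1\le i\le r$ and $\underline{\alpha}_j\in\mathbb{N}^{n_j+1}$ with $|\underline{\alpha}_j|=d_{i,j}$ for all $j$. Let $C=A[\underline{X}_1,\dots,\underline{X}_s]$ and let $f_i=\sum U_{i,\underline{\alpha}_1,\dots,\underline{\alpha}_s}\underline{X}_1^{\underline{\alpha}_1}\cdots\underline{X}_s^{\underline{\alpha}_s}\in C$ (sum over all $(\underline{\alpha}_j)_j$ with $|\underline{\alpha}_j|=d_{i,j}$) be the generic plurihomogeneous polynomials. Put $B=C/(f_1,\dots,f_r)$. For $(i_1,\dots,i_s)\in\prod_{j=1}^s\{1,\dots,n_j+1\}$ put $\sigma_{i_1\dots i_s}=X_{1,i_1}\cdots X_{s,i_s}$. Let $p:C\to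 B$ be the canonical surjection and $\pi:B\to\prod_{i_1,\dots,i_s}B_{\sigma_{i_1\dots i_s}}$, $b\mapsto(b/1,\dots,b/1)$, the map to the product of the localizations. The ideal of forms of inertia of $f_1,\dots,f_r$ is $\mathcal{T}=p^{-1}(\ker\pi)\subset C$; its elements are called forms of inertia. *)

theory Defs
  imports "HOL-Library.Poly_Mapping" "HOL-Algebra.QuotRing"
begin

section \<open>Polynomial rings over a prescribed set of indeterminates\<close>

text \<open>
  The type \<open>('v \<Rightarrow>\<^sub>0 nat) \<Rightarrow>\<^sub>0 'a\<close> is the polynomial ring over \<open>'a\<close> in one indeterminate for
  each element of \<open>'v\<close>.  Its subring of polynomials in the indeterminates from \<open>V\<close> with
  coefficients in the subring \<open>R\<close> of \<open>'a\<close> is the polynomial ring \<open>R[V]\<close>.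
\<close>

definition monomials :: "'v set \<Rightarrow> ('v \<Rightarrow>\<^sub>0 nat) set" where
  "monomials V = {m. Poly_Mapping.keys m \<subseteq> V}"

definition mpoly_ring :: "'v set \<Rightarrow> 'a::comm_ring_1 set \<Rightarrow> (('v \<Rightarrow>\<^sub>0 nat) \<Rightarrow>\<^sub>0 'a) ring" where
  "mpoly_ring V R =
    \<lparr>carrier = {p. Poly_Mapping.keys p \<subseteq> monomials V \<and> (\<forall>m. Poly_Mapping.lookup p m \<in> R)},
     mult = (*), one = 1, zero = 0, add = (+)\<rparr>"

section \<open>Localization and products of rings\<close>

definition frac_rel ::
  "('a, 'm) ring_scheme \<Rightarrow> 'a set \<Rightarrow> (('a \<times> 'a) \<times> ('a \<times> 'a)) set" where
  "frac_rel R S = {((a, s), (b, t)). a \<in> carrier R \<and> s \<in> S \<and> b \<in> carrier R \<and> t \<in> S \<and>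
     (\<exists>u\<in>S. u \<otimes>\<^bsub>R\<^esub> (a \<otimes>\<^bsub>R\<^esub> t) = u \<otimes>\<^bsub>R\<^esub> (b \<otimes>\<^bsub>R\<^esub> s))}"

definition frac :: "('a, 'm) ring_scheme \<Rightarrow> 'a set \<Rightarrow> 'a \<Rightarrow> 'a \<Rightarrow> ('a \<times> 'a) set" where
  "frac R S a s = frac_rel R S `` {(a, s)}"

text \<open>
  The unions below are unions of equal equivalence classes: sum and product of fractions do not
  depend on the choice of representatives.
\<close>

definition localization :: "('a, 'm) ring_scheme \<Rightarrow> 'a set \<Rightarrow> ('a \<times> 'a) set ring" where
  "localization R S =
    \<lparr>carrier = (carrier R \<times> S) // frac_rel R S,
     mult = (\<lambda>x y. \<Union>(a, s)\<in>x. \<Union>(b, t)\<in>y. frac R S (a \<otimes>\<^bsub>R\<^esub> b) (s \<otimes>\<^bsub>R\<^esub> t)),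
     one = frac R S \<one>\<^bsub>R\<^esub> \<one>\<^bsub>R\<^esub>,
     zero = frac R S \<zero>\<^bsub>R\<^esub> \<one>\<^bsub>R\<^esub>,
     add = (\<lambda>x y. \<Union>(a, s)\<in>x. \<Union>(b, t)\<in>y.
              frac R S (a \<otimes>\<^bsub>R\<^esub> t \<oplus>\<^bsub>R\<^esub> b \<otimes>\<^bsub>R\<^esub> s) (s \<otimes>\<^bsub>R\<^esub> t))\<rparr>"

definition powers :: "('a, 'm) ring_scheme \<Rightarrow> 'a \<Rightarrow> 'a set" where
  "powers R g = {g [^]\<^bsub>R\<^esub> k |k::nat. True}"

definition product_ring :: "'i set \<Rightarrow> ('i \<Rightarrow> ('a, 'm) ring_scheme) \<Rightarrow> ('i \<Rightarrow> 'a) ring" where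
  "product_ring I R =
    \<lparr>carrier = (\<Pi>\<^sub>E i\<in>I. carrier (R i)),
     mult = (\<lambda>x y. \<lambda>i\<in>I. x i \<otimes>\<^bsub>R i\<^esub> y i),
     one = (\<lambda>i\<in>I. \<one>\<^bsub>R i\<^esub>),
     zero = (\<lambda>i\<in>I. \<zero>\<^bsub>R i\<^esub>),
     add = (\<lambda>x y. \<lambda>i\<in>I. x i \<oplus>\<^bsub>R i\<^esub> y i)\<rparr>"

section \<open>Generic plurihomogeneous polynomials\<close>

text \<open>
  The pair \<open>(j, l)\<close> stands for \<open>X\<^bsub>j,l\<^esub>\<close>.  A tuple of multi-exponents
  \<open>(\<alpha>\<^sub>1, \<dots>, \<alpha>\<^sub>s)\<close> is encoded as one finitely supported function \<open>\<alpha>\<close> on these pairs,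
  with \<open>\<alpha>\<^bsub>j,l\<^esub>\<close> its value at \<open>(j, l)\<close>.
\<close>

type_synonym xmon = "(nat \<times> nat) \<Rightarrow>\<^sub>0 nat"
type_synonym 'k apoly = "((nat \<times> xmon) \<Rightarrow>\<^sub>0 nat) \<Rightarrow>\<^sub>0 'k"
type_synonym 'k cpoly = "xmon \<Rightarrow>\<^sub>0 'k apoly"

definition xvars :: "nat \<Rightarrow> (nat \<Rightarrow> nat) \<Rightarrow> (nat \<times> nat) set" where
  "xvars s n = (SIGMA j:{1..s}. {1..n j + 1})"

definition pdeg :: "(nat \<Rightarrow> nat) \<Rightarrow> nat \<Rightarrow> xmon \<Rightarrow> nat" where
  "pdeg n j \<alpha> = (\<Sum>l = 1..n j + 1. Poly_Mapping.lookup \<alpha> (j, l))"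

definition exponents :: "nat \<Rightarrow> (nat \<Rightarrow> nat) \<Rightarrow> (nat \<Rightarrow> nat) \<Rightarrow> xmon set" where
  "exponents s n e = {\<alpha> \<in> monomials (xvars s n). \<forall>j\<in>{1..s}. pdeg n j \<alpha> = e j}"

lemma finite_exponents: "finite (exponents s n e)"
proof -
  let ?V = "xvars s n"
  let ?F = "{f. \<forall>v. (v \<in> ?V \<longrightarrow> f v \<in> {..\<Sum>j\<in>{1..s}. e j}) \<and> (v \<notin> ?V \<longrightarrow> f v = 0)}"
  have fin: "finite ?V" by (simp add: xvars_def)
  have "Poly_Mapping.lookup \<alpha> \<in> ?F" if a: "\<alpha> \<in> exponents s n e" for \<alpha>
  proof -
    have "Poly_Mapping.lookup \<alpha> (j, l) \<le> (\<Sum>j\<in>{1..s}. e j)" if "(j, l) \<in> ?V" for j l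
    proof -
      have jl: "j \<in> {1..s}" "l \<in> {1..n j + 1}" using that by (auto simp: xvars_def)
      have "Poly_Mapping.lookup \<alpha> (j, l) \<le> pdeg n j \<alpha>"
        unfolding pdeg_def by (rule member_le_sum[of l _ "\<lambda>l. Poly_Mapping.lookup \<alpha> (j, l)"]) (use jl in auto)
      also have "\<dots> = e j" using a jl by (auto simp: exponents_def)
      also have "\<dots> \<le> (\<Sum>j\<in>{1..s}. e j)" by (rule member_le_sum) (use jl in auto)
      finally show ?thesis .
    qed
    moreover have "Poly_Mapping.lookup \<alpha> v = 0" if "v \<notin> ?V" for v
      using a that by (auto simp: exponents_def monomials_def in_keys_iff)
    ultimately show ?thesis by auto
  qed
  hence "Poly_Mapping.lookup ` exponents s n e \<subseteq> ?F" by (rule image_subsetI)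
  moreover have "finite ?F" by (rule finite_set_of_finite_funs[OF fin]) simp
  ultimately have "finite (Poly_Mapping.lookup ` exponents s n e)" by (rule finite_subset)
  thus ?thesis by (rule finite_imageD) (simp add: inj_on_def lookup_inject)
qed

text \<open>\<open>(i, \<alpha>)\<close> stands for \<open>U\<^bsub>i,\<alpha>\<^esub>\<close>.\<close>

definition uvars ::
  "nat \<Rightarrow> (nat \<Rightarrow> nat) \<Rightarrow> nat \<Rightarrow> (nat \<Rightarrow> nat \<Rightarrow> nat) \<Rightarrow> (nat \<times> xmon) set" where
  "uvars s n r d = (SIGMA i:{1..r}. exponents s n (d i))"

definition A_ring ::
  "nat \<Rightarrow> (nat \<Rightarrow> nat) \<Rightarrow> nat \<Rightarrow> (nat \<Rightarrow> nat \<Rightarrow> nat) \<Rightarrow> 'k::idom apoly ring" where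
  "A_ring s n r d = mpoly_ring (uvars s n r d) UNIV"

definition C_ring ::
  "nat \<Rightarrow> (nat \<Rightarrow> nat) \<Rightarrow> nat \<Rightarrow> (nat \<Rightarrow> nat \<Rightarrow> nat) \<Rightarrow> 'k::idom cpoly ring" where
  "C_ring s n r d = mpoly_ring (xvars s n) (carrier (A_ring s n r d))"

definition uvar :: "nat \<Rightarrow> xmon \<Rightarrow> 'k::idom apoly" where
  "uvar i \<alpha> = Poly_Mapping.single (Poly_Mapping.single (i, \<alpha>) 1) 1"

definition xmonom :: "xmon \<Rightarrow> 'k::idom cpoly" where
  "xmonom \<alpha> = Poly_Mapping.single \<alpha> 1"

text \<open>\<open>single \<alpha> (uvar i \<alpha>)\<close> is the term \<open>U\<^bsub>i,\<alpha>\<^esub> X\<^sup>\<alpha>\<close>.\<close>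

definition generic_poly ::
  "nat \<Rightarrow> (nat \<Rightarrow> nat) \<Rightarrow> (nat \<Rightarrow> nat \<Rightarrow> nat) \<Rightarrow> nat \<Rightarrow> 'k::idom cpoly" where
  "generic_poly s n d i = (\<Sum>\<alpha>\<in>exponents s n (d i). Poly_Mapping.single \<alpha> (uvar i \<alpha>))"

definition generic_ideal ::
  "nat \<Rightarrow> (nat \<Rightarrow> nat) \<Rightarrow> nat \<Rightarrow> (nat \<Rightarrow> nat \<Rightarrow> nat) \<Rightarrow> 'k::idom cpoly set" where
  "generic_ideal s n r d = Idl\<^bsub>C_ring s n r d\<^esub> (generic_poly s n d ` {1..r})"

section \<open>Forms of inertia\<close>

definition B_ring ::
  "nat \<Rightarrow> (nat \<Rightarrow> nat) \<Rightarrow> nat \<Rightarrow> (nat \<Rightarrow> nat \<Rightarrow> nat) \<Rightarrow> 'k::idom cpoly set ring" where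
  "B_ring s n r d = C_ring s n r d Quot generic_ideal s n r d"

definition proj_B ::
  "nat \<Rightarrow> (nat \<Rightarrow> nat) \<Rightarrow> nat \<Rightarrow> (nat \<Rightarrow> nat \<Rightarrow> nat) \<Rightarrow> 'k::idom cpoly \<Rightarrow> 'k cpoly set" where
  "proj_B s n r d c = generic_ideal s n r d +>\<^bsub>C_ring s n r d\<^esub> c"

text \<open>An index tuple \<open>(i\<^sub>1, \<dots>, i\<^sub>s)\<close> is the extensional function \<open>j \<mapsto> i\<^sub>j\<close> on \<open>{1..s}\<close>.\<close>

definition index_tuples :: "nat \<Rightarrow> (nat \<Rightarrow> nat) \<Rightarrow> (nat \<Rightarrow> nat) set" where
  "index_tuples s n = (\<Pi>\<^sub>E j\<in>{1..s}. {1..n j + 1})"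

definition sigma :: "nat \<Rightarrow> (nat \<Rightarrow> nat) \<Rightarrow> 'k::idom cpoly" where
  "sigma s \<iota> = (\<Prod>j = 1..s. xmonom (Poly_Mapping.single (j, \<iota> j) 1))"

definition sigma_powers ::
  "nat \<Rightarrow> (nat \<Rightarrow> nat) \<Rightarrow> nat \<Rightarrow> (nat \<Rightarrow> nat \<Rightarrow> nat) \<Rightarrow> (nat \<Rightarrow> nat) \<Rightarrow> 'k::idom cpoly set set" where
  "sigma_powers s n r d \<iota> = powers (B_ring s n r d) (proj_B s n r d (sigma s \<iota>))"

definition B_localizations ::
  "nat \<Rightarrow> (nat \<Rightarrow> nat) \<Rightarrow> nat \<Rightarrow> (nat \<Rightarrow> nat \<Rightarrow> nat) \<Rightarrow>
   ((nat \<Rightarrow> nat) \<Rightarrow> ('k::idom cpoly set \<times> 'k cpoly set) set) ring" where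
  "B_localizations s n r d = product_ring (index_tuples s n)
     (\<lambda>\<iota>. localization (B_ring s n r d) (sigma_powers s n r d \<iota>))"

definition pi_map ::
  "nat \<Rightarrow> (nat \<Rightarrow> nat) \<Rightarrow> nat \<Rightarrow> (nat \<Rightarrow> nat \<Rightarrow> nat) \<Rightarrow> 'k::idom cpoly set \<Rightarrow>
   (nat \<Rightarrow> nat) \<Rightarrow> ('k cpoly set \<times> 'k cpoly set) set" where
  "pi_map s n r d b =
     (\<lambda>\<iota>\<in>index_tuples s n.
        frac (B_ring s n r d) (sigma_powers s n r d \<iota>) b \<one>\<^bsub>B_ring s n r d\<^esub>)"

definition inertia_forms ::
  "nat \<Rightarrow> (nat \<Rightarrow> nat) \<Rightarrow> nat \<Rightarrow> (nat \<Rightarrow> nat \<Rightarrow> nat) \<Rightarrow> 'k::idom cpoly set" where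
  "inertia_forms s n r d = {f \<in> carrier (C_ring s n r d).
     proj_B s n r d f \<in> a_kernel (B_ring s n r d) (B_localizations s n r d) (pi_map s n r d)}"

end

theory Submission
  imports Defs "HOL-Library.Product_Lexorder" "HOL-Computational_Algebra.Polynomial_Factorial"
begin

text \<open>
  Write \<open>I\<close> for the ideal of \<open>f\<^sub>1, \<dots>, f\<^sub>r\<close>.  Membership in the kernel of the map to the product of
  localizations says that, for every \<open>\<iota>\<close> separately, some power of \<open>\<sigma>\<^sub>\<iota>\<close> multiplies \<open>f\<close> into \<open>I\<close>;
  as there are finitely many \<open>\<iota>\<close>, one exponent \<open>\<nu>\<close> serves all of them.  Then all monomials of
  a large multidegree multiply \<open>f\<close> into \<open>I\<close> by the pigeonhole principle: a monomial of degree at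
  least \<open>(n\<^sub>j + 1) \<nu>\<close> in the \<open>n\<^sub>j + 1\<close> indeterminates of the \<open>j\<close>-th packet is divisible by the
  \<open>\<nu>\<close>-th power of one of them.  Conversely, a high power of any single \<open>\<sigma>\<^sub>\<iota>\<close> is divisible by a
  monomial of any prescribed multidegree.

  The substance is the step from one \<open>\<iota>\<close> to all of them: if some monomial multiplies \<open>f\<close> into
  \<open>I\<close>, then for each \<open>\<iota>\<close> a power of \<open>\<sigma>\<^sub>\<iota>\<close> does.  Fix \<open>\<iota>\<close>.  Among the terms of \<open>f\<^sub>i\<close> is the one
  whose monomial \<open>c\<^sub>i\<close> is a product of powers of the \<open>X\<^bsub>j,\<iota> j\<^esub>\<close> only; let \<open>U\<^sub>i\<close> be its
  coefficient, so that \<open>f\<^sub>i = c\<^sub>i U\<^sub>i + h\<^sub>i\<close> with \<open>h\<^sub>i\<close> free of \<open>U\<^sub>1, \<dots>, U\<^sub>r\<close>.  After inverting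
  \<open>\<sigma>\<^sub>\<iota>\<close>, the equation \<open>f\<^sub>i = 0\<close> can be solved for \<open>U\<^sub>i\<close>.  Thus the substitution
  \<open>U\<^sub>i \<mapsto> - h\<^sub>i / c\<^sub>i\<close>, a homomorphism from \<open>C\<close> to its field of fractions, kills \<open>I\<close>
  (\<open>elimination_generic_poly\<close>), and up to a power of \<open>\<sigma>\<^sub>\<iota>\<close> its value at \<open>g\<close> is represented by a
  polynomial congruent to \<open>g\<close> modulo \<open>I\<close> (\<open>elimination_denominator\<close>).  So an element of the kernel
  is multiplied into \<open>I\<close> by a power of \<open>\<sigma>\<^sub>\<iota>\<close>.  The substitution takes values in a field and
  fixes monomials; hence if a monomial times \<open>f\<close> lies in \<open>I\<close>, then \<open>f\<close> is in its kernel
  (\<open>sigma_power_torsion_of_monomial_torsion\<close>).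
\<close>

section \<open>Expansion and evaluation of polynomials\<close>

abbreviation "keys \<equiv> Poly_Mapping.keys"
abbreviation "lookup \<equiv> Poly_Mapping.lookup"
abbreviation "single \<equiv> Poly_Mapping.single"

lemma sum_single_keys: "(\<Sum>m\<in>keys p. single m (lookup p m)) = p"
  by (rule poly_mapping_eqI)
    (auto simp: lookup_sum lookup_single when_def in_keys_iff)

lemma times_eq_sum_single:
  fixes p q :: "'m::monoid_add \<Rightarrow>\<^sub>0 'a::semiring_0"
  shows "p * q = (\<Sum>a\<in>keys p. \<Sum>b\<in>keys q. single (a + b) (lookup p a * lookup q b))"
proof -
  have "p * q = (\<Sum>a\<in>keys p. single a (lookup p a)) * (\<Sum>b\<in>keys q. single b (lookup q b))"
    by (simp add: sum_single_keys)
  thus ?thesis by (simp add: sum_product mult_single)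
qed

lemma power_single_var: "(single (single v (1::nat)) (1::'a::comm_semiring_1)) ^ k = single (single v k) 1"
  by (induction k) (simp_all add: mult_single flip: single_add)

lemma prod_single_one:
  "(\<Prod>i\<in>I. single (f i) (1::'a::comm_semiring_1)) = single (\<Sum>i\<in>I. f i) 1"
  for f :: "'i \<Rightarrow> 'm::comm_monoid_add"
  by (induction I rule: infinite_finite_induct) (simp_all add: mult_single)

definition monom_eval :: "('v \<Rightarrow> 'b::comm_semiring_1) \<Rightarrow> ('v \<Rightarrow>\<^sub>0 nat) \<Rightarrow> 'b" where
  "monom_eval \<tau> u = (\<Prod>v\<in>keys u. \<tau> v ^ lookup u v)"

lemma monom_eval_superset:
  "finite F \<Longrightarrow> keys u \<subseteq> F \<Longrightarrow> monom_eval \<tau> u = (\<Prod>v\<in>F. \<tau> v ^ lookup u v)"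
  unfolding monom_eval_def
  by (rule prod.mono_neutral_left) (auto simp: in_keys_iff)

lemma monom_eval_zero [simp]: "monom_eval \<tau> 0 = 1"
  by (simp add: monom_eval_def)

lemma monom_eval_add: "monom_eval \<tau> (u + w) = monom_eval \<tau> u * monom_eval \<tau> w"
proof -
  let ?F = "keys u \<union> keys w"
  have "monom_eval \<tau> (u + w) = (\<Prod>v\<in>?F. \<tau> v ^ lookup (u + w) v)"
    by (rule monom_eval_superset) (simp_all add: Poly_Mapping.keys_add)
  also have "\<dots> = (\<Prod>v\<in>?F. \<tau> v ^ lookup u v) * (\<Prod>v\<in>?F. \<tau> v ^ lookup w v)"
    by (simp add: lookup_add power_add prod.distrib)
  finally show ?thesis by (simp add: monom_eval_superset[of ?F])
qed

text \<open>
  Being a product of indeterminates, a monomial lies in every ring containing them; this is the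
  form in which that is used to show that a polynomial ring is generated by its indeterminates.
\<close>

lemma monom_eval_var: "monom_eval (\<lambda>v. single (single v 1) 1) u = single u (1::'a::comm_semiring_1)"
  by (simp add: monom_eval_def power_single_var[simplified] prod_single_one sum_single_keys)

text \<open>
  Homomorphisms between rings given as types, as opposed to rings with a carrier; the rings of
  the form \<open>mpoly_ring V R\<close> are subrings of such a type.
\<close>

definition ring_map :: "('a::comm_ring_1 \<Rightarrow> 'b::comm_ring_1) \<Rightarrow> bool" where
  "ring_map h \<longleftrightarrow> h 1 = 1 \<and> (\<forall>x y. h (x + y) = h x + h y) \<and> (\<forall>x y. h (x * y) = h x * h y)"

lemma ring_mapD:
  assumes "ring_map h"
  shows "h 1 = 1" "h (x + y) = h x + h y" "h (x * y) = h x * h y"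
  using assms by (simp_all add: ring_map_def)

lemma ring_map_zero: "ring_map h \<Longrightarrow> h 0 = 0"
  unfolding ring_map_def by (metis add_cancel_right_right)

lemma ring_map_sum: "ring_map h \<Longrightarrow> h (\<Sum>i\<in>I. f i) = (\<Sum>i\<in>I. h (f i))"
  by (induction I rule: infinite_finite_induct) (auto simp: ring_map_zero, auto simp: ring_map_def)

lemma ring_map_minus: "ring_map h \<Longrightarrow> h (- x) = - h x"
  by (metis add.inverse_unique add.right_inverse ring_map_def ring_map_zero)

definition poly_eval :: "('a \<Rightarrow> 'b) \<Rightarrow> ('m \<Rightarrow> 'b) \<Rightarrow> ('m \<Rightarrow>\<^sub>0 'a::zero) \<Rightarrow> 'b::comm_ring_1" where
  "poly_eval h \<theta> p = (\<Sum>m\<in>keys p. h (lookup p m) * \<theta> m)"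

lemma poly_eval_single: "h 0 = 0 \<Longrightarrow> poly_eval h \<theta> (single m c) = h c * \<theta> m"
  by (simp add: poly_eval_def)

lemma ring_map_poly_eval:
  fixes h :: "'a::comm_ring_1 \<Rightarrow> 'b::comm_ring_1" and \<theta> :: "'m::comm_monoid_add \<Rightarrow> 'b"
  assumes h: "ring_map h" and \<theta>0: "\<theta> 0 = 1" and \<theta>: "\<And>u w. \<theta> (u + w) = \<theta> u * \<theta> w"
  shows "ring_map (poly_eval h \<theta>)"
proof -
  note h0 = ring_map_zero[OF h]
  have add: "poly_eval h \<theta> (p + q) = poly_eval h \<theta> p + poly_eval h \<theta> q" for p q
    unfolding poly_eval_def
    by (rule setsum_keys_plus_distrib) (use h in \<open>auto simp: h0 ring_map_def distrib_right\<close>)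
  have sum: "poly_eval h \<theta> (\<Sum>i\<in>I. f i) = (\<Sum>i\<in>I. poly_eval h \<theta> (f i))" for I :: "'i set" and f
    by (induction I rule: infinite_finite_induct) (auto simp: add, auto simp: poly_eval_def)
  have "poly_eval h \<theta> (p * q) = poly_eval h \<theta> p * poly_eval h \<theta> q" for p q
  proof -
    have "poly_eval h \<theta> (p * q)
        = (\<Sum>a\<in>keys p. \<Sum>b\<in>keys q. h (lookup p a * lookup q b) * \<theta> (a + b))"
      by (simp add: times_eq_sum_single[of p q] sum poly_eval_single h0)
    also have "\<dots> = (\<Sum>a\<in>keys p. \<Sum>b\<in>keys q. (h (lookup p a) * \<theta> a) * (h (lookup q b) * \<theta> b))"
      using h by (simp add: ring_map_def \<theta> mult_ac)
    also have "\<dots> = poly_eval h \<theta> p * poly_eval h \<theta> q"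
      by (simp add: poly_eval_def sum_product)
    finally show ?thesis .
  qed
  moreover have "poly_eval h \<theta> 1 = 1"
    using poly_eval_single[of h \<theta> 0 1] h by (simp add: h0 \<theta>0 ring_map_def)
  ultimately show ?thesis using add by (simp add: ring_map_def)
qed

section \<open>Polynomial rings as subrings of a type\<close>

definition unital_subring :: "'a::comm_ring_1 set \<Rightarrow> bool" where
  "unital_subring R \<longleftrightarrow> 1 \<in> R \<and> (\<forall>x\<in>R. - x \<in> R) \<and> (\<forall>x\<in>R. \<forall>y\<in>R. x + y \<in> R \<and> x * y \<in> R)"

lemma unital_subringD:
  assumes "unital_subring R"
  shows "0 \<in> R" "1 \<in> R" "x \<in> R \<Longrightarrow> - x \<in> R"
    "x \<in> R \<Longrightarrow> y \<in> R \<Longrightarrow> x + y \<in> R" "x \<in> R \<Longrightarrow> y \<in> R \<Longrightarrow> x * y \<in> R"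
proof -
  show "0 \<in> R" using assms unfolding unital_subring_def by (metis add.right_inverse)
qed (use assms in \<open>auto simp: unital_subring_def\<close>)

lemma unital_subring_sum:
  "unital_subring R \<Longrightarrow> (\<And>i. i \<in> I \<Longrightarrow> f i \<in> R) \<Longrightarrow> (\<Sum>i\<in>I. f i) \<in> R"
  by (induction I rule: infinite_finite_induct) (auto simp: unital_subringD)

lemma unital_subring_power: "unital_subring R \<Longrightarrow> x \<in> R \<Longrightarrow> x ^ k \<in> R"
  by (induction k) (auto simp: unital_subringD)

lemma unital_subring_prod:
  "unital_subring R \<Longrightarrow> (\<And>i. i \<in> I \<Longrightarrow> f i \<in> R) \<Longrightarrow> (\<Prod>i\<in>I. f i) \<in> R"
  by (induction I rule: infinite_finite_induct) (auto simp: unital_subringD)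

lemma unital_subring_UNIV: "unital_subring UNIV"
  by (simp add: unital_subring_def)

lemma mpoly_ring_simps:
  "p \<otimes>\<^bsub>mpoly_ring V R\<^esub> q = p * q" "\<one>\<^bsub>mpoly_ring V R\<^esub> = 1"
  "p \<oplus>\<^bsub>mpoly_ring V R\<^esub> q = p + q" "\<zero>\<^bsub>mpoly_ring V R\<^esub> = 0"
  by (simp_all add: mpoly_ring_def)

lemma mem_mpoly_ring:
  "p \<in> carrier (mpoly_ring V R) \<longleftrightarrow> keys p \<subseteq> monomials V \<and> (\<forall>m. lookup p m \<in> R)"
  by (simp add: mpoly_ring_def)

lemma monomials_zero: "0 \<in> monomials V"
  by (simp add: monomials_def)

lemma monomials_add: "a \<in> monomials V \<Longrightarrow> b \<in> monomials V \<Longrightarrow> a + b \<in> monomials V"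
  using Poly_Mapping.keys_add[of a b] by (auto simp: monomials_def)

lemma single_in_mpoly_ring:
  "unital_subring R \<Longrightarrow> m \<in> monomials V \<Longrightarrow> c \<in> R \<Longrightarrow> single m c \<in> carrier (mpoly_ring V R)"
  by (auto simp: mem_mpoly_ring lookup_single when_def unital_subringD)

lemma unital_subring_mpoly_ring:
  assumes R: "unital_subring R"
  shows "unital_subring (carrier (mpoly_ring V R))"
proof -
  let ?P = "carrier (mpoly_ring V R)"
  have one: "1 \<in> ?P"
    using single_in_mpoly_ring[OF R monomials_zero unital_subringD(2)[OF R]] by simp
  have zero: "0 \<in> ?P" using R by (auto simp: mem_mpoly_ring unital_subringD)
  have minus: "- p \<in> ?P" if "p \<in> ?P" for p
    using that R by (auto simp: mem_mpoly_ring unital_subringD in_keys_iff)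
  have add: "p + q \<in> ?P" if "p \<in> ?P" "q \<in> ?P" for p q
    using that R Poly_Mapping.keys_add[of p q] by (auto simp: mem_mpoly_ring unital_subringD lookup_add)
  have sum: "(\<Sum>i\<in>I. f i) \<in> ?P" if "\<And>i. i \<in> I \<Longrightarrow> f i \<in> ?P" for I :: "'i set" and f
    using that by (induction I rule: infinite_finite_induct) (auto simp: add zero)
  have "p * q \<in> ?P" if "p \<in> ?P" "q \<in> ?P" for p q
    unfolding times_eq_sum_single[of p q]
    by (intro sum single_in_mpoly_ring[OF R] monomials_add)
      (use that R in \<open>auto simp: mem_mpoly_ring unital_subringD\<close>)
  thus ?thesis using one minus add by (simp add: unital_subring_def)
qed

lemma cring_mpoly_ring:
  assumes R: "unital_subring R"
  shows "cring (mpoly_ring V R)"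
proof -
  note S = unital_subringD[OF unital_subring_mpoly_ring[OF R, of V]]
  have "\<exists>q\<in>carrier (mpoly_ring V R). q + p = 0" if "p \<in> carrier (mpoly_ring V R)" for p
    using S(3)[OF that] by (intro bexI[of _ "- p"]) auto
  thus ?thesis
    by (intro cringI abelian_groupI comm_monoidI)
      (auto simp: mpoly_ring_simps S algebra_simps)
qed

text \<open>
  The induction principle for polynomial rings: a property that is stable under the ring
  operations needs to be checked on constants and indeterminates only.
\<close>

lemma mpoly_ring_subset:
  assumes S: "unital_subring S"
    and const: "\<And>c. c \<in> R \<Longrightarrow> single 0 c \<in> S"
    and var: "\<And>v. v \<in> V \<Longrightarrow> single (single v 1) 1 \<in> S"
  shows "carrier (mpoly_ring V R) \<subseteq> S"
proof
  fix p assume p: "p \<in> carrier (mpoly_ring V R)"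
  have "single m (lookup p m) \<in> S" if "m \<in> keys p" for m
  proof -
    have "monom_eval (\<lambda>v. single (single v 1) 1) m \<in> S"
      unfolding monom_eval_def
      using p that
      by (intro unital_subring_prod unital_subring_power S var) (auto simp: mem_mpoly_ring monomials_def)
    hence "single m 1 \<in> S" by (simp only: monom_eval_var)
    moreover have "single 0 (lookup p m) \<in> S" using p by (intro const) (auto simp: mem_mpoly_ring)
    ultimately have "single m 1 * single 0 (lookup p m) \<in> S" using S by (simp add: unital_subringD)
    thus ?thesis by (simp add: mult_single)
  qed
  hence "(\<Sum>m\<in>keys p. single m (lookup p m)) \<in> S" by (intro unital_subring_sum S)
  thus "p \<in> S" by (simp add: sum_single_keys)
qed

section \<open>Vanishing in a localization\<close>

text \<open>
  If \<open>u\<close> annihilates \<open>b\<close>, then multiplication by \<open>u\<close> turns a witness for \<open>(c, t)\<close> lying in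
  the class of \<open>b / 1\<close> into one for the class of \<open>0 / 1\<close>, and conversely, so the classes agree
  element by element.
\<close>

lemma (in cring) frac_eq_zero_iff:
  assumes S: "S \<subseteq> carrier R" "\<one> \<in> S" "\<And>x y. x \<in> S \<Longrightarrow> y \<in> S \<Longrightarrow> x \<otimes> y \<in> S"
    and b: "b \<in> carrier R"
  shows "Defs.frac R S b \<one> = Defs.frac R S \<zero> \<one> \<longleftrightarrow> (\<exists>u\<in>S. u \<otimes> b = \<zero>)"
proof
  have mem: "(c, t) \<in> Defs.frac R S a \<one> \<longleftrightarrow> c \<in> carrier R \<and> t \<in> S \<and> (\<exists>v\<in>S. v \<otimes> (a \<otimes> t) = v \<otimes> c)"
    if a: "a \<in> carrier R" for a c t
    using a S(2) by (auto simp: Defs.frac_def frac_rel_def)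
  {
    assume eq: "Defs.frac R S b \<one> = Defs.frac R S \<zero> \<one>"
    have "\<one> \<otimes> (\<zero> \<otimes> \<one>) = \<one> \<otimes> \<zero>" by simp
    hence "(\<zero>, \<one>) \<in> Defs.frac R S \<zero> \<one>"
      using S(2) unfolding mem[OF zero_closed] by blast
    hence "(\<zero>, \<one>) \<in> Defs.frac R S b \<one>" by (simp only: eq)
    then obtain u where u: "u \<in> S" "u \<otimes> (b \<otimes> \<one>) = u \<otimes> \<zero>" unfolding mem[OF b] by blast
    have "u \<in> carrier R" using u(1) S(1) by blast
    hence "u \<otimes> b = \<zero>" using u(2) b by simp
    thus "\<exists>u\<in>S. u \<otimes> b = \<zero>" using u(1) by blast
  }
  assume "\<exists>u\<in>S. u \<otimes> b = \<zero>"
  then obtain u where u: "u \<in> S" "u \<otimes> b = \<zero>" by blast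
  have uc: "u \<in> carrier R" using u(1) S(1) by blast
  have "(\<exists>v\<in>S. v \<otimes> (b \<otimes> t) = v \<otimes> c) \<longleftrightarrow> (\<exists>v\<in>S. v \<otimes> (\<zero> \<otimes> t) = v \<otimes> c)"
    if c: "c \<in> carrier R" and t: "t \<in> S" for c t
  proof -
    have tc: "t \<in> carrier R" using S(1) t by blast
    have *: "(u \<otimes> v) \<otimes> (b \<otimes> t) = \<zero>" "v \<otimes> (\<zero> \<otimes> t) = \<zero>" "(u \<otimes> v) \<otimes> (\<zero> \<otimes> t) = \<zero>"
      "(u \<otimes> v) \<otimes> c = u \<otimes> (v \<otimes> c)" "u \<otimes> v \<in> S" if v: "v \<in> S" for v
    proof -
      have vc: "v \<in> carrier R" using S(1) v by blast
      have "(u \<otimes> v) \<otimes> (b \<otimes> t) = (u \<otimes> b) \<otimes> (v \<otimes> t)" using vc uc tc b by (simp add: m_ac)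
      thus "(u \<otimes> v) \<otimes> (b \<otimes> t) = \<zero>" using u(2) vc tc by simp
      show "v \<otimes> (\<zero> \<otimes> t) = \<zero>" "(u \<otimes> v) \<otimes> (\<zero> \<otimes> t) = \<zero>" "(u \<otimes> v) \<otimes> c = u \<otimes> (v \<otimes> c)"
        using vc uc tc c by (simp_all add: m_assoc)
      show "u \<otimes> v \<in> S" by (rule S(3)[OF u(1) v])
    qed
    show ?thesis
    proof
      assume "\<exists>v\<in>S. v \<otimes> (b \<otimes> t) = v \<otimes> c"
      then obtain v where v: "v \<in> S" "v \<otimes> (b \<otimes> t) = v \<otimes> c" by blast
      have vc: "v \<in> carrier R" using S(1) v(1) by blast
      have "(u \<otimes> v) \<otimes> c = u \<otimes> (v \<otimes> (b \<otimes> t))" using *(4)[OF v(1)] v(2) by simp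
      also have "\<dots> = (u \<otimes> v) \<otimes> (b \<otimes> t)" using vc uc tc b by (simp add: m_assoc)
      finally have "(u \<otimes> v) \<otimes> (\<zero> \<otimes> t) = (u \<otimes> v) \<otimes> c" using *(1,3)[OF v(1)] by simp
      thus "\<exists>v\<in>S. v \<otimes> (\<zero> \<otimes> t) = v \<otimes> c" using *(5)[OF v(1)] by blast
    next
      assume "\<exists>v\<in>S. v \<otimes> (\<zero> \<otimes> t) = v \<otimes> c"
      then obtain v where v: "v \<in> S" "v \<otimes> (\<zero> \<otimes> t) = v \<otimes> c" by blast
      have "v \<otimes> c = \<zero>" using v(2) *(2)[OF v(1)] by simp
      hence "(u \<otimes> v) \<otimes> (b \<otimes> t) = (u \<otimes> v) \<otimes> c" using *(1,4)[OF v(1)] uc by simp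
      thus "\<exists>v\<in>S. v \<otimes> (b \<otimes> t) = v \<otimes> c" using *(5)[OF v(1)] by blast
    qed
  qed
  hence "(c, t) \<in> Defs.frac R S b \<one> \<longleftrightarrow> (c, t) \<in> Defs.frac R S \<zero> \<one>" for c t
    unfolding mem[OF b] mem[OF zero_closed] by blast
  thus "Defs.frac R S b \<one> = Defs.frac R S \<zero> \<one>" by auto
qed

section \<open>Monomials supported on one index tuple\<close>

text \<open>
  For an index tuple \<open>\<iota>\<close>, the exponent of \<open>X\<^bsub>1,\<iota> 1\<^esub>\<^bsup>e 1\<^esup> \<cdots> X\<^bsub>s,\<iota> s\<^esub>\<^bsup>e s\<^esup>\<close>,
  a vertex of the polytope of all exponents of multidegree \<open>e\<close>.  Powers of \<open>\<sigma>\<^sub>\<iota>\<close> are the case of constant \<open>e\<close>.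
\<close>

definition corner :: "nat \<Rightarrow> (nat \<Rightarrow> nat) \<Rightarrow> (nat \<Rightarrow> nat) \<Rightarrow> xmon" where
  "corner s \<iota> e = (\<Sum>j = 1..s. single (j, \<iota> j) (e j))"

lemma lookup_corner:
  "lookup (corner s \<iota> e) (j, l) = (if j \<in> {1..s} \<and> l = \<iota> j then e j else 0)"
proof -
  have "lookup (corner s \<iota> e) (j, l) = (\<Sum>k = 1..s. if k = j then (if l = \<iota> j then e j else 0) else 0)"
    unfolding corner_def lookup_sum by (rule sum.cong) (auto simp: lookup_single when_def)
  thus ?thesis by simp
qed

lemma corner_add: "corner s \<iota> (\<lambda>j. e j + e' j) = corner s \<iota> e + corner s \<iota> e'"
  by (rule poly_mapping_eqI) (auto simp: lookup_add lookup_corner split: prod.splits)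

lemma corner_split:
  assumes "\<And>j. j \<in> {1..s} \<Longrightarrow> e j \<le> e' j"
  shows "corner s \<iota> e' = corner s \<iota> (\<lambda>j. e' j - e j) + corner s \<iota> e"
  unfolding corner_add[symmetric] unfolding corner_def by (rule sum.cong) (use assms in auto)

lemma corner_in_exponents:
  assumes "\<iota> \<in> index_tuples s n"
  shows "corner s \<iota> e \<in> exponents s n e"
proof -
  have \<iota>: "\<iota> j \<in> {1..n j + 1}" if "j \<in> {1..s}" for j
    using assms that by (auto simp: index_tuples_def PiE_def Pi_def)
  have "keys (corner s \<iota> e) \<subseteq> xvars s n"
  proof
    fix v assume "v \<in> keys (corner s \<iota> e)"
    thus "v \<in> xvars s n" using \<iota>
      by (cases v) (auto simp: in_keys_iff lookup_corner xvars_def split: if_splits)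
  qed
  moreover have "pdeg n j (corner s \<iota> e) = e j" if "j \<in> {1..s}" for j
    using that \<iota>[OF that] by (simp add: pdeg_def lookup_corner)
  ultimately show ?thesis by (simp add: exponents_def monomials_def)
qed

lemma exponents_subset_monomials: "exponents s n e \<subseteq> monomials (xvars s n)"
  by (auto simp: exponents_def)

lemma xmonom_add: "xmonom (a + b) = xmonom a * xmonom b"
  by (simp add: xmonom_def mult_single)

lemma sigma_power_eq: "sigma s \<iota> ^ N = xmonom (corner s \<iota> (\<lambda>_. N))"
proof (induction N)
  case 0
  show ?case by (simp add: xmonom_def corner_def)
next
  case (Suc N)
  have "sigma s \<iota> = (xmonom (corner s \<iota> (\<lambda>_. 1)) :: 'a cpoly)"
    by (simp add: sigma_def xmonom_def corner_def prod_single_one)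
  thus ?case using Suc corner_add[of s \<iota> "\<lambda>_. 1" "\<lambda>_. N"] by (simp add: xmonom_add)
qed

section \<open>The ring C and the ideal of the generic polynomials\<close>

lemma unital_subring_A: "unital_subring (carrier (A_ring s n r d))"
  unfolding A_ring_def by (intro unital_subring_mpoly_ring unital_subring_UNIV)

lemma unital_subring_C: "unital_subring (carrier (C_ring s n r d))"
  unfolding C_ring_def by (intro unital_subring_mpoly_ring unital_subring_A)

lemma cring_C: "cring (C_ring s n r d)"
  unfolding C_ring_def by (intro cring_mpoly_ring unital_subring_A)

lemma C_ring_simps:
  "p \<otimes>\<^bsub>C_ring s n r d\<^esub> q = p * q" "\<one>\<^bsub>C_ring s n r d\<^esub> = 1"
  "p \<oplus>\<^bsub>C_ring s n r d\<^esub> q = p + q" "\<zero>\<^bsub>C_ring s n r d\<^esub> = 0"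
  by (simp_all add: C_ring_def mpoly_ring_simps)

lemmas C_closed = unital_subringD[OF unital_subring_C]

lemma single_in_C:
  "m \<in> monomials (xvars s n) \<Longrightarrow> c \<in> carrier (A_ring s n r d) \<Longrightarrow> single m c \<in> carrier (C_ring s n r d)"
  unfolding C_ring_def by (intro single_in_mpoly_ring unital_subring_A)

lemma xmonom_in_C: "m \<in> monomials (xvars s n) \<Longrightarrow> xmonom m \<in> carrier (C_ring s n r d)"
  unfolding xmonom_def by (intro single_in_C unital_subringD(2)[OF unital_subring_A])

lemma sigma_power_in_C:
  "\<iota> \<in> index_tuples s n \<Longrightarrow> sigma s \<iota> ^ N \<in> carrier (C_ring s n r d)"
  unfolding sigma_power_eq
  by (intro xmonom_in_C subsetD[OF exponents_subset_monomials corner_in_exponents])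

lemma uvar_in_A:
  "(i, \<alpha>) \<in> uvars s n r d \<Longrightarrow> uvar i \<alpha> \<in> carrier (A_ring s n r d)"
  unfolding uvar_def A_ring_def
  by (intro single_in_mpoly_ring unital_subring_UNIV) (auto simp: monomials_def)

lemma term_in_C:
  "i \<in> {1..r} \<Longrightarrow> \<alpha> \<in> exponents s n (d i) \<Longrightarrow> single \<alpha> (uvar i \<alpha>) \<in> carrier (C_ring s n r d)"
  by (intro single_in_C uvar_in_A) (auto simp: uvars_def exponents_def)

lemma generic_poly_in_C:
  "i \<in> {1..r} \<Longrightarrow> generic_poly s n d i \<in> carrier (C_ring s n r d)"
  unfolding generic_poly_def by (intro unital_subring_sum unital_subring_C term_in_C)

lemma ideal_generic_ideal: "ideal (generic_ideal s n r d) (C_ring s n r d)"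
  unfolding generic_ideal_def
  by (intro ring.genideal_ideal cring.axioms(1)[OF cring_C]) (auto intro: generic_poly_in_C)

lemma generic_poly_in_ideal:
  "i \<in> {1..r} \<Longrightarrow> generic_poly s n d i \<in> generic_ideal s n r d"
  unfolding generic_ideal_def
  by (rule subsetD[OF ring.genideal_self[OF cring.axioms(1)[OF cring_C]]])
    (auto intro: generic_poly_in_C)

lemma generic_ideal_closed:
  shows "x \<in> generic_ideal s n r d \<Longrightarrow> x \<in> carrier (C_ring s n r d)"
    and "0 \<in> generic_ideal s n r d"
    and "x \<in> generic_ideal s n r d \<Longrightarrow> y \<in> generic_ideal s n r d \<Longrightarrow> x + y \<in> generic_ideal s n r d"
    and "c \<in> carrier (C_ring s n r d) \<Longrightarrow> x \<in> generic_ideal s n r d \<Longrightarrow> c * x \<in> generic_ideal s n r d"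
proof -
  interpret ideal "generic_ideal s n r d" "C_ring s n r d" by (rule ideal_generic_ideal)
  show "x \<in> generic_ideal s n r d \<Longrightarrow> x \<in> carrier (C_ring s n r d)"
    and "0 \<in> generic_ideal s n r d"
    and "x \<in> generic_ideal s n r d \<Longrightarrow> y \<in> generic_ideal s n r d \<Longrightarrow> x + y \<in> generic_ideal s n r d"
    and "c \<in> carrier (C_ring s n r d) \<Longrightarrow> x \<in> generic_ideal s n r d \<Longrightarrow> c * x \<in> generic_ideal s n r d"
    using additive_subgroup.zero_closed[OF is_additive_subgroup] Icarr
      additive_subgroup.a_closed[OF is_additive_subgroup, of x y] I_l_closed[of x c] by (simp_all add: C_ring_simps)
qed

lemma generic_ideal_uminus:
  "x \<in> generic_ideal s n r d \<Longrightarrow> - x \<in> generic_ideal s n r d"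
  using generic_ideal_closed(4)[OF C_closed(3)[OF C_closed(2)], of x] by simp

lemma ring_map_zero_on_generic_ideal:
  assumes h: "ring_map h" and gen: "\<And>i. i \<in> {1..r} \<Longrightarrow> h (generic_poly s n d i) = 0"
    and x: "x \<in> generic_ideal s n r d"
  shows "h x = 0"
proof -
  interpret cring "C_ring s n r d" by (rule cring_C)
  let ?J = "{x \<in> carrier (C_ring s n r d). h x = 0}"
  note hs = h[unfolded ring_map_def] ring_map_zero[OF h] ring_map_minus[OF h]
  have "ideal ?J (C_ring s n r d)"
  proof (rule idealI[OF local.ring_axioms])
    show "subgroup ?J (add_monoid (C_ring s n r d))"
    proof
      fix x assume x: "x \<in> ?J"
      have "\<ominus>\<^bsub>C_ring s n r d\<^esub> x = - x"
        by (rule minus_equality) (use x in \<open>auto simp: C_ring_simps C_closed\<close>)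
      thus "inv\<^bsub>add_monoid (C_ring s n r d)\<^esub> x \<in> ?J"
        using x hs by (simp add: a_inv_def C_closed)
    qed (use hs in \<open>auto simp: C_ring_simps C_closed\<close>)
  qed (use hs in \<open>auto simp: C_ring_simps C_closed\<close>)
  hence "generic_ideal s n r d \<subseteq> ?J"
    unfolding generic_ideal_def by (rule genideal_minimal) (auto simp: gen generic_poly_in_C)
  thus ?thesis using x by auto
qed

section \<open>Solving the generic equations for one coefficient each\<close>

text \<open>
  This is \<open>h\<^sub>i\<close>, the part of \<open>f\<^sub>i\<close> in which no corner coefficient occurs.
\<close>

definition tail_poly ::
  "nat \<Rightarrow> (nat \<Rightarrow> nat) \<Rightarrow> (nat \<Rightarrow> nat \<Rightarrow> nat) \<Rightarrow> (nat \<Rightarrow> nat) \<Rightarrow> nat \<Rightarrow> 'k::idom cpoly" where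
  "tail_poly s n d \<iota> i =
     (\<Sum>\<alpha>\<in>exponents s n (d i) - {corner s \<iota> (d i)}. single \<alpha> (uvar i \<alpha>))"

lemma generic_poly_split:
  assumes "\<iota> \<in> index_tuples s n"
  shows "generic_poly s n d i =
    xmonom (corner s \<iota> (d i)) * single 0 (uvar i (corner s \<iota> (d i))) + tail_poly s n d \<iota> i"
  unfolding generic_poly_def tail_poly_def
  by (subst sum.remove[OF finite_exponents corner_in_exponents[OF assms]])
    (simp add: xmonom_def mult_single)

text \<open>
  The corner coefficient of each \<open>f\<^sub>i\<close> goes to the value that makes \<open>f\<^sub>i\<close> vanish; all
  other coefficients stay put.
\<close>

definition elimination_var ::
  "nat \<Rightarrow> (nat \<Rightarrow> nat) \<Rightarrow> nat \<Rightarrow> (nat \<Rightarrow> nat \<Rightarrow> nat) \<Rightarrow> (nat \<Rightarrow> nat) \<Rightarrow>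
    nat \<times> xmon \<Rightarrow> 'k::idom cpoly fract" where
  "elimination_var s n r d \<iota> = (\<lambda>(i, \<alpha>).
     if i \<in> {1..r} \<and> \<alpha> = corner s \<iota> (d i)
     then - to_fract (tail_poly s n d \<iota> i) / to_fract (xmonom \<alpha>)
     else to_fract (single 0 (uvar i \<alpha>)))"

text \<open>
  The target is a field because \<open>C\<close> is a domain, which for polynomials in infinitely many
  indeterminates is derived from a linear order on these; pairs are ordered lexicographically.
  The inner evaluation substitutes for the coefficients \<open>U\<^bsub>i,\<alpha>\<^esub>\<close>, the outer one fixes the \<open>X\<^bsub>j,l\<^esub>\<close>.
\<close>

definition elimination ::
  "nat \<Rightarrow> (nat \<Rightarrow> nat) \<Rightarrow> nat \<Rightarrow> (nat \<Rightarrow> nat \<Rightarrow> nat) \<Rightarrow> (nat \<Rightarrow> nat) \<Rightarrow>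
    'k::idom cpoly \<Rightarrow> 'k cpoly fract" where
  "elimination s n r d \<iota> =
     poly_eval (poly_eval (\<lambda>k. to_fract (single 0 (single 0 k))) (monom_eval (elimination_var s n r d \<iota>)))
       (\<lambda>m. to_fract (xmonom m))"

lemma xmonom_nonzero: "xmonom m \<noteq> (0 :: 'k::idom cpoly)"
  by (metis xmonom_def lookup_single_eq lookup_zero zero_neq_one)

lemma ring_map_coefficients:
  "ring_map (poly_eval (\<lambda>k. to_fract (single 0 (single 0 k)) :: 'k::idom cpoly fract)
     (monom_eval \<tau> :: ((nat \<times> xmon) \<Rightarrow>\<^sub>0 nat) \<Rightarrow> _))"
proof (rule ring_map_poly_eval)
  have "to_fract (single 0 (single 0 (x * y))) =
      (to_fract (single 0 (single 0 x)) * to_fract (single 0 (single 0 y)) :: 'k cpoly fract)" for x y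
    by (simp add: mult_single flip: to_fract_mult)
  thus "ring_map (\<lambda>k. to_fract (single 0 (single 0 k)) :: 'k cpoly fract)"
    by (simp add: ring_map_def single_add)
qed (simp_all add: monom_eval_add)

lemma ring_map_elimination: "ring_map (elimination s n r d \<iota>)"
  unfolding elimination_def
  by (rule ring_map_poly_eval[OF ring_map_coefficients]) (simp_all add: xmonom_add, simp add: xmonom_def)

lemmas elimination_hom = ring_mapD[OF ring_map_elimination] ring_map_minus[OF ring_map_elimination]

lemma elimination_single: "elimination s n r d \<iota> (single m c) = elimination s n r d \<iota> (single 0 c) * to_fract (xmonom m)"
proof -
  have "xmonom 0 = (1 :: 'a cpoly)" by (simp add: xmonom_def)
  thus ?thesis
    unfolding elimination_def by (simp add: poly_eval_single ring_map_zero[OF ring_map_coefficients])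
qed

lemma elimination_xmonom: "elimination s n r d \<iota> (xmonom m) = to_fract (xmonom m)"
  unfolding xmonom_def by (subst elimination_single) (simp add: elimination_hom xmonom_def)

lemma elimination_const: "elimination s n r d \<iota> (single 0 (single 0 k)) = to_fract (single 0 (single 0 k))"
  by (simp add: elimination_def poly_eval_single xmonom_def ring_map_zero[OF ring_map_coefficients])
  

lemma elimination_uvar: "elimination s n r d \<iota> (single 0 (uvar i \<alpha>)) = elimination_var s n r d \<iota> (i, \<alpha>)"
  by (simp add: elimination_def uvar_def poly_eval_single xmonom_def ring_map_zero[OF ring_map_coefficients]
      monom_eval_def)

lemma elimination_term:
  assumes "i \<in> {1..r} \<Longrightarrow> \<alpha> \<noteq> corner s \<iota> (d i)"
  shows "elimination s n r d \<iota> (single \<alpha> (uvar i \<alpha>)) = to_fract (single \<alpha> (uvar i \<alpha>))"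
  unfolding elimination_single[of _ _ _ _ _ \<alpha>] elimination_uvar
  using assms by (auto simp: elimination_var_def xmonom_def mult_single simp flip: to_fract_mult)

text \<open>
  The tail is unchanged because the corner coefficient of \<open>f\<^sub>i\<close> does not occur in it, and the
  corner coefficients of the other \<open>f\<^sub>k\<close> carry a different first index.
\<close>

lemma elimination_tail_poly: "elimination s n r d \<iota> (tail_poly s n d \<iota> i) = to_fract (tail_poly s n d \<iota> i)"
proof -
  have "to_fract (\<Sum>i\<in>I. f i) = (\<Sum>i\<in>I. to_fract (f i))" for I :: "xmon set" and f :: "_ \<Rightarrow> 'a cpoly"
    by (induction I rule: infinite_finite_induct) auto
  thus ?thesis by (simp add: tail_poly_def ring_map_sum[OF ring_map_elimination] elimination_term)
qed

lemma elimination_generic_poly: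
  assumes "\<iota> \<in> index_tuples s n" "i \<in> {1..r}"
  shows "elimination s n r d \<iota> (generic_poly s n d i) = 0"
proof -
  have "elimination s n r d \<iota> (generic_poly s n d i) =
    to_fract (xmonom (corner s \<iota> (d i))) * elimination_var s n r d \<iota> (i, corner s \<iota> (d i))
      + to_fract (tail_poly s n d \<iota> i)"
    by (simp add: generic_poly_split[OF assms(1)] elimination_hom elimination_xmonom elimination_uvar elimination_tail_poly)
  also have "\<dots> = 0" using assms(2) by (simp add: elimination_var_def xmonom_nonzero)
  finally show ?thesis .
qed

text \<open>
  This expresses that the substitution is the identity modulo \<open>I\<close> once \<open>\<sigma>\<^sub>\<iota>\<close> is inverted: the
  value at \<open>g\<close> is \<open>y / \<sigma>\<^sub>\<iota>\<^sup>N\<close> with \<open>y\<close> congruent to \<open>\<sigma>\<^sub>\<iota>\<^sup>N g\<close>.  The elements \<open>g\<close> with such a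
  representation form a subring, by addition and multiplication of fractions, so it suffices
  to treat generators.  For the corner coefficient of \<open>f\<^sub>i\<close> the difference \<open>y - \<sigma>\<^sub>\<iota>\<^sup>N g\<close> is
  a multiple of \<open>f\<^sub>i\<close>; all other generators are fixed, with \<open>N = 0\<close>.
\<close>

lemma elimination_denominator:
  fixes g :: "'k::idom cpoly"
  assumes \<iota>: "\<iota> \<in> index_tuples s n" and g: "g \<in> carrier (C_ring s n r d)"
  shows "\<exists>N y. y - sigma s \<iota> ^ N * g \<in> generic_ideal s n r d \<and>
    to_fract (sigma s \<iota> ^ N) * elimination s n r d \<iota> g = to_fract y"
proof -
  let ?I = "generic_ideal s n r d :: 'k cpoly set" and ?C = "carrier (C_ring s n r d) :: 'k cpoly set"
    and ?e = "elimination s n r d \<iota> :: 'k cpoly \<Rightarrow> 'k cpoly fract"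
  define P where "P = (\<lambda>N y g. y - sigma s \<iota> ^ N * g \<in> ?I \<and> to_fract (sigma s \<iota> ^ N) * ?e g = to_fract y)"
  define L where "L = {g \<in> ?C. \<exists>N y. P N y g}"
  note sC = sigma_power_in_C[OF \<iota>]
  have numer: "y \<in> ?C" if "P N y g" "g \<in> ?C" for N y g
  proof -
    have "(y - sigma s \<iota> ^ N * g) + sigma s \<iota> ^ N * g \<in> ?C"
      by (rule C_closed(4)[OF generic_ideal_closed(1) C_closed(5)[OF sC]]) (use that in \<open>simp_all add: P_def\<close>)
    thus ?thesis by simp
  qed
  \<comment> \<open>Elements fixed by the substitution are their own numerator, with exponent \<open>0\<close>.\<close>
  have exact: "g \<in> L" if "g \<in> ?C" "?e g = to_fract g" for g
  proof -
    have "P 0 g g" using that by (simp add: P_def generic_ideal_closed)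
    thus ?thesis using that by (auto simp: L_def)
  qed
  have L: "unital_subring L"
    unfolding unital_subring_def
  proof (intro conjI ballI)
    show "1 \<in> L" by (intro exact) (auto simp: C_closed elimination_hom)
    fix g assume gL: "g \<in> L"
    then obtain N y where g: "g \<in> ?C" "P N y g" by (auto simp: L_def)
    have "P N (- y) (- g)" using g generic_ideal_uminus[of "y - sigma s \<iota> ^ N * g"] by (auto simp: P_def elimination_hom)
    thus "- g \<in> L" using g by (auto simp: L_def C_closed)
    fix h assume "h \<in> L"
    then obtain M z where h: "h \<in> ?C" "P M z h" by (auto simp: L_def)
    have y: "y \<in> ?C" and z: "z \<in> ?C" using numer g h by auto
    have "P (N + M) (sigma s \<iota> ^ M * y + sigma s \<iota> ^ N * z) (g + h)"
    proof -
      have "sigma s \<iota> ^ M * (y - sigma s \<iota> ^ N * g) + sigma s \<iota> ^ N * (z - sigma s \<iota> ^ M * h) \<in> ?I"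
        using g h by (intro generic_ideal_closed(3,4) sC) (auto simp: P_def)
      also have "sigma s \<iota> ^ M * (y - sigma s \<iota> ^ N * g) + sigma s \<iota> ^ N * (z - sigma s \<iota> ^ M * h)
          = (sigma s \<iota> ^ M * y + sigma s \<iota> ^ N * z) - sigma s \<iota> ^ (N + M) * (g + h)"
        by (simp add: power_add algebra_simps)
      finally have I: "(sigma s \<iota> ^ M * y + sigma s \<iota> ^ N * z) - sigma s \<iota> ^ (N + M) * (g + h) \<in> ?I" .
      have "to_fract (sigma s \<iota> ^ (N + M)) * ?e (g + h)
          = to_fract (sigma s \<iota> ^ M) * (to_fract (sigma s \<iota> ^ N) * ?e g)
            + to_fract (sigma s \<iota> ^ N) * (to_fract (sigma s \<iota> ^ M) * ?e h)"
        by (simp add: power_add algebra_simps elimination_hom)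
      also have "\<dots> = to_fract (sigma s \<iota> ^ M * y + sigma s \<iota> ^ N * z)" using g h by (simp add: P_def)
      finally show ?thesis using I by (simp add: P_def)
    qed
    thus "g + h \<in> L" using g h by (auto simp: L_def C_closed)
    have "P (N + M) (y * z) (g * h)"
    proof -
      have "y * (z - sigma s \<iota> ^ M * h) + (sigma s \<iota> ^ M * h) * (y - sigma s \<iota> ^ N * g) \<in> ?I"
        using g h by (intro generic_ideal_closed(3,4) sC y C_closed(5)) (auto simp: P_def)
      also have "y * (z - sigma s \<iota> ^ M * h) + (sigma s \<iota> ^ M * h) * (y - sigma s \<iota> ^ N * g)
          = y * z - sigma s \<iota> ^ (N + M) * (g * h)"
        by (simp add: power_add algebra_simps)
      finally have I: "y * z - sigma s \<iota> ^ (N + M) * (g * h) \<in> ?I" .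
      have "to_fract (sigma s \<iota> ^ (N + M)) * ?e (g * h)
          = (to_fract (sigma s \<iota> ^ N) * ?e g) * (to_fract (sigma s \<iota> ^ M) * ?e h)"
        by (simp add: power_add algebra_simps elimination_hom)
      also have "\<dots> = to_fract (y * z)" using g h by (simp add: P_def)
      finally show ?thesis using I by (simp add: P_def)
    qed
    thus "g * h \<in> L" using g h by (auto simp: L_def C_closed)
  qed
  have var: "single 0 (uvar i \<alpha>) \<in> L" if v: "(i, \<alpha>) \<in> uvars s n r d" for i \<alpha>
  proof (cases "\<alpha> = corner s \<iota> (d i)")
    case False
    thus ?thesis using v
      by (intro exact single_in_C uvar_in_A) (auto simp: monomials_def elimination_uvar elimination_var_def)
  next
    case True
    have i: "i \<in> {1..r}" using v by (auto simp: uvars_def)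
    \<comment> \<open>Any bound for the \<open>d i j\<close>, with this \<open>i\<close>, works; it makes \<open>c\<^sub>i\<close> a divisor of \<open>\<sigma>\<^sub>\<iota>\<^sup>N\<close>, with cofactor \<open>w\<close>.\<close>
    define N where "N = (\<Sum>j = 1..s. d i j)"
    define w where "w = corner s \<iota> (\<lambda>j. N - d i j)"
    have "corner s \<iota> (\<lambda>_. N) = w + \<alpha>"
      unfolding w_def True by (rule corner_split) (auto simp: N_def intro!: member_le_sum)
    hence \<sigma>: "sigma s \<iota> ^ N = (xmonom w * xmonom \<alpha> :: 'k cpoly)"
      by (simp add: sigma_power_eq xmonom_add)
    have w: "xmonom w \<in> ?C"
      unfolding w_def by (intro xmonom_in_C subsetD[OF exponents_subset_monomials corner_in_exponents[OF \<iota>]])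
    have "P N (- (xmonom w * tail_poly s n d \<iota> i)) (single 0 (uvar i \<alpha>))"
    proof -
      have "- (xmonom w * generic_poly s n d i) \<in> ?I"
        using i by (intro generic_ideal_uminus generic_ideal_closed(4) w generic_poly_in_ideal)
      also have "- (xmonom w * generic_poly s n d i)
          = (- (xmonom w * tail_poly s n d \<iota> i) - sigma s \<iota> ^ N * single 0 (uvar i \<alpha>) :: 'k cpoly)"
        by (simp add: \<sigma> generic_poly_split[OF \<iota>] True algebra_simps)
      finally have I: "- (xmonom w * tail_poly s n d \<iota> i) - sigma s \<iota> ^ N * single 0 (uvar i \<alpha>) \<in> ?I" .
      have "to_fract (sigma s \<iota> ^ N) * ?e (single 0 (uvar i \<alpha>))
          = to_fract (xmonom w) * (to_fract (xmonom \<alpha>) * elimination_var s n r d \<iota> (i, \<alpha>))"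
        by (simp add: \<sigma> elimination_uvar)
      also have "\<dots> = to_fract (- (xmonom w * tail_poly s n d \<iota> i))"
        using i by (simp add: True elimination_var_def xmonom_nonzero)
      finally show ?thesis using I by (simp add: P_def)
    qed
    thus ?thesis using v by (auto simp: L_def monomials_def intro!: single_in_C uvar_in_A)
  qed
  have const: "single 0 c \<in> L" if c: "c \<in> carrier (A_ring s n r d)" for c
  proof -
    have "carrier (A_ring s n r d) \<subseteq> {c. single 0 c \<in> L}"
      unfolding A_ring_def
    proof (rule mpoly_ring_subset)
      note Ls = unital_subringD[OF L]
      have "(single 0 (x * y) :: 'k cpoly) = single 0 x * single 0 y" for x y by (simp add: mult_single)
      thus "unital_subring {c. single 0 c \<in> L}"
        unfolding unital_subring_def using Ls by (auto simp: single_add single_uminus)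
      show "single 0 k \<in> {c. single 0 c \<in> L}" for k
        using single_in_mpoly_ring[OF unital_subring_UNIV monomials_zero]
        by (auto intro!: exact single_in_C simp: elimination_const A_ring_def monomials_zero)
      show "single (single v 1) 1 \<in> {c. single 0 c \<in> L}" if "v \<in> uvars s n r d" for v
        using var[of "fst v" "snd v"] that by (simp add: uvar_def)
    qed
    thus ?thesis using c by auto
  qed
  have "?C \<subseteq> L"
    unfolding C_ring_def
  proof (rule mpoly_ring_subset[OF L const])
    fix v assume v: "v \<in> xvars s n"
    have "xmonom (single v 1) \<in> L"
      using v by (intro exact xmonom_in_C elimination_xmonom) (auto simp: monomials_def)
    thus "single (single v 1) 1 \<in> L" by (simp add: xmonom_def)
  qed
  thus ?thesis using g by (auto simp: L_def P_def)
qed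

text \<open>
  In terms of rings: inverting \<open>\<sigma>\<^sub>\<iota>\<close> turns \<open>B\<close> into a domain in which no monomial becomes
  zero, so a monomial can be cancelled there.
\<close>

lemma sigma_power_torsion_of_monomial_torsion:
  assumes \<iota>: "\<iota> \<in> index_tuples s n" and f: "f \<in> carrier (C_ring s n r d)"
    and m: "xmonom m * f \<in> generic_ideal s n r d"
  shows "\<exists>N. sigma s \<iota> ^ N * f \<in> generic_ideal s n r d"
proof -
  have "elimination s n r d \<iota> (xmonom m * f) = 0"
    by (rule ring_map_zero_on_generic_ideal[OF ring_map_elimination elimination_generic_poly[OF \<iota>] m])
  hence f0: "elimination s n r d \<iota> f = 0"
    by (simp add: elimination_hom elimination_xmonom xmonom_nonzero)
  obtain N y where "y - sigma s \<iota> ^ N * f \<in> generic_ideal s n r d"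
    "to_fract (sigma s \<iota> ^ N) * elimination s n r d \<iota> f = to_fract y"
    using elimination_denominator[OF \<iota> f] by blast
  with f0 have "- (sigma s \<iota> ^ N * f) \<in> generic_ideal s n r d" by simp
  hence "- (- (sigma s \<iota> ^ N * f)) \<in> generic_ideal s n r d" by (rule generic_ideal_uminus)
  thus ?thesis by auto
qed

section \<open>Forms of inertia\<close>

lemma proj_B_power:
  fixes c :: "'k::idom cpoly"
  assumes c: "c \<in> carrier (C_ring s n r d)"
  shows "proj_B s n r d c [^]\<^bsub>B_ring s n r d\<^esub> (k::nat) = proj_B s n r d (c ^ k)"
proof -
  interpret I: ideal "generic_ideal s n r d" "C_ring s n r d :: 'k cpoly ring" by (rule ideal_generic_ideal)
  interpret h: ring_hom_ring "C_ring s n r d :: 'k cpoly ring" "B_ring s n r d" "proj_B s n r d"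
    unfolding B_ring_def proj_B_def by (rule I.rcos_ring_hom_ring)
  show ?thesis
  proof (induction k)
    case 0
    show ?case using h.hom_one by (simp add: C_ring_simps)
  next
    case (Suc k)
    have "c ^ k \<in> carrier (C_ring s n r d)" by (intro unital_subring_power unital_subring_C c)
    thus ?case using Suc h.hom_mult[of "c ^ k" c] c by (simp add: C_ring_simps mult.commute)
  qed
qed

lemma proj_B_eq_zero_iff:
  fixes c :: "'k::idom cpoly"
  assumes "c \<in> carrier (C_ring s n r d)"
  shows "proj_B s n r d c = \<zero>\<^bsub>B_ring s n r d\<^esub> \<longleftrightarrow> c \<in> generic_ideal s n r d"
proof -
  interpret ideal "generic_ideal s n r d" "C_ring s n r d :: 'k cpoly ring" by (rule ideal_generic_ideal)
  show ?thesis
    using assms a_rcos_self[of c] a_rcos_const[of c]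
    by (auto simp: proj_B_def B_ring_def FactRing_def)
qed

text \<open>
  A fraction \<open>b / 1\<close> vanishes exactly when a power of the inverted element kills \<open>b\<close>, and in the
  quotient \<open>B\<close> this means membership in the ideal.  The exponent here may depend on \<open>\<iota>\<close>.
\<close>

lemma inertia_forms_iff:
  fixes f :: "'k::idom cpoly"
  assumes f: "f \<in> carrier (C_ring s n r d)"
  shows "f \<in> inertia_forms s n r d \<longleftrightarrow>
    (\<forall>\<iota>\<in>index_tuples s n. \<exists>N. sigma s \<iota> ^ N * f \<in> generic_ideal s n r d)"
proof -
  let ?p = "proj_B s n r d :: 'k cpoly \<Rightarrow> 'k cpoly set" and ?B = "B_ring s n r d :: 'k cpoly set ring"
  interpret I: ideal "generic_ideal s n r d" "C_ring s n r d :: 'k cpoly ring" by (rule ideal_generic_ideal)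
  interpret h: ring_hom_ring "C_ring s n r d :: 'k cpoly ring" ?B ?p
    unfolding B_ring_def proj_B_def by (rule I.rcos_ring_hom_ring)
  interpret B: cring ?B
    unfolding B_ring_def by (rule I.quotient_is_cring[OF cring_C])
  have loc: "Defs.frac ?B (sigma_powers s n r d \<iota>) (?p f) \<one>\<^bsub>?B\<^esub> = \<zero>\<^bsub>localization ?B (sigma_powers s n r d \<iota>)\<^esub>
      \<longleftrightarrow> (\<exists>N. sigma s \<iota> ^ N * f \<in> generic_ideal s n r d)"
    if \<iota>: "\<iota> \<in> index_tuples s n" for \<iota>
  proof -
    have \<sigma>: "sigma s \<iota> \<in> carrier (C_ring s n r d)" using sigma_power_in_C[OF \<iota>, of 1] by simp
    have S: "sigma_powers s n r d \<iota> = range (\<lambda>N. ?p (sigma s \<iota> ^ N))"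
      by (auto simp: sigma_powers_def powers_def proj_B_power[OF \<sigma>])
    have mult: "?p (sigma s \<iota> ^ N) \<otimes>\<^bsub>?B\<^esub> ?p g = ?p (sigma s \<iota> ^ N * g)"
      if "g \<in> carrier (C_ring s n r d)" for N g
      using h.hom_mult[OF sigma_power_in_C[OF \<iota>] that] by (simp add: C_ring_simps)
    have "Defs.frac ?B (sigma_powers s n r d \<iota>) (?p f) \<one>\<^bsub>?B\<^esub> = Defs.frac ?B (sigma_powers s n r d \<iota>) \<zero>\<^bsub>?B\<^esub> \<one>\<^bsub>?B\<^esub>
      \<longleftrightarrow> (\<exists>u\<in>sigma_powers s n r d \<iota>. u \<otimes>\<^bsub>?B\<^esub> ?p f = \<zero>\<^bsub>?B\<^esub>)"
    proof (rule B.frac_eq_zero_iff)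
      show "sigma_powers s n r d \<iota> \<subseteq> carrier ?B"
        unfolding S by (rule image_subsetI) (rule h.hom_closed[OF sigma_power_in_C[OF \<iota>]])
      have "\<one>\<^bsub>?B\<^esub> = ?p (sigma s \<iota> ^ 0)" using h.hom_one by (simp add: C_ring_simps)
      thus "\<one>\<^bsub>?B\<^esub> \<in> sigma_powers s n r d \<iota>" unfolding S by (rule image_eqI) simp
      fix x y assume "x \<in> (sigma_powers s n r d \<iota> :: 'k cpoly set set)" "y \<in> (sigma_powers s n r d \<iota> :: 'k cpoly set set)"
      then obtain M N where xy: "x = ?p (sigma s \<iota> ^ M)" "y = ?p (sigma s \<iota> ^ N)" by (auto simp: S)
      have "x \<otimes>\<^bsub>?B\<^esub> y = ?p (sigma s \<iota> ^ (M + N))"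
        unfolding xy mult[OF sigma_power_in_C[OF \<iota>]] by (simp add: power_add)
      thus "x \<otimes>\<^bsub>?B\<^esub> y \<in> sigma_powers s n r d \<iota>" by (simp add: S)
    qed (use f in simp)
    also have "\<dots> \<longleftrightarrow> (\<exists>N. ?p (sigma s \<iota> ^ N * f) = \<zero>\<^bsub>?B\<^esub>)"
      by (auto simp: S mult[OF f])
    also have "\<dots> \<longleftrightarrow> (\<exists>N. sigma s \<iota> ^ N * f \<in> generic_ideal s n r d)"
      using C_closed(5)[OF sigma_power_in_C[OF \<iota>] f] by (simp add: proj_B_eq_zero_iff)
    finally show ?thesis by (simp add: localization_def)
  qed
  have restrict_eq: "restrict F I = restrict G I \<longleftrightarrow> (\<forall>i\<in>I. F i = G i)" for F G :: "'i \<Rightarrow> 'v" and I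
    unfolding restrict_def fun_eq_iff by auto
  have "f \<in> inertia_forms s n r d \<longleftrightarrow> pi_map s n r d (?p f) = \<zero>\<^bsub>B_localizations s n r d\<^esub>"
    unfolding inertia_forms_def a_kernel_def' using f h.hom_closed[OF f] by blast
  also have "\<dots> \<longleftrightarrow> (\<forall>\<iota>\<in>index_tuples s n. Defs.frac ?B (sigma_powers s n r d \<iota>) (?p f) \<one>\<^bsub>?B\<^esub>
      = \<zero>\<^bsub>localization ?B (sigma_powers s n r d \<iota>)\<^esub>)"
    unfolding pi_map_def B_localizations_def product_ring_def ring.simps by (rule restrict_eq)
  also have "\<dots> \<longleftrightarrow> (\<forall>\<iota>\<in>index_tuples s n. \<exists>N. sigma s \<iota> ^ N * f \<in> generic_ideal s n r d)"
    by (rule ball_cong[OF refl loc])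
  finally show ?thesis .
qed

lemma finite_index_tuples: "finite (index_tuples s n)"
  by (simp add: index_tuples_def finite_PiE)

text \<open>
  By the pigeonhole principle, one of the \<open>n j + 1\<close> exponents in the \<open>j\<close>-th packet is at
  least \<open>N\<close>; choosing it for every \<open>j\<close> gives \<open>\<iota>\<close>.
\<close>

lemma exponent_divisible_by_corner:
  assumes \<alpha>: "\<alpha> \<in> exponents s n (\<lambda>j. (n j + 1) * N)"
  obtains \<iota> \<beta> where "\<iota> \<in> index_tuples s n" "\<beta> \<in> monomials (xvars s n)" "\<alpha> = \<beta> + corner s \<iota> (\<lambda>_. N)"
proof -
  have "\<exists>l\<in>{1..n j + 1}. N \<le> lookup \<alpha> (j, l)" if j: "j \<in> {1..s}" for j
  proof (rule ccontr)
    assume "\<not> ?thesis"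
    hence "lookup \<alpha> (j, l) < N" if "l \<in> {1..n j + 1}" for l using that by (meson not_le)
    hence "(\<Sum>l = 1..n j + 1. lookup \<alpha> (j, l)) < (\<Sum>l = 1..n j + 1. N)"
      by (intro sum_strict_mono) auto
    thus False using \<alpha> j by (auto simp: exponents_def pdeg_def)
  qed
  then obtain l where l: "\<And>j. j \<in> {1..s} \<Longrightarrow> l j \<in> {1..n j + 1} \<and> N \<le> lookup \<alpha> (j, l j)"
    by metis
  define \<iota> where "\<iota> = restrict l {1..s}"
  have \<iota>: "\<iota> \<in> index_tuples s n" using l by (auto simp: \<iota>_def index_tuples_def)
  have "lookup (corner s \<iota> (\<lambda>_. N)) v \<le> lookup \<alpha> v" for v
    using l by (cases v) (auto simp: lookup_corner \<iota>_def)
  hence "\<alpha> = (\<alpha> - corner s \<iota> (\<lambda>_. N)) + corner s \<iota> (\<lambda>_. N)"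
    by (intro poly_mapping_eqI) (simp add: lookup_add lookup_minus)
  moreover have "keys (\<alpha> - corner s \<iota> (\<lambda>_. N)) \<subseteq> keys \<alpha>"
    by (auto simp: in_keys_iff lookup_minus)
  hence "\<alpha> - corner s \<iota> (\<lambda>_. N) \<in> monomials (xvars s n)"
    using \<alpha> by (auto simp: exponents_def monomials_def)
  ultimately show thesis using that \<iota> by blast
qed

theorem proposition3p1:
  fixes s r :: nat and n :: "nat \<Rightarrow> nat" and d :: "nat \<Rightarrow> nat \<Rightarrow> nat"
    and f :: "'k::idom cpoly"
  assumes s: "1 \<le> s"
    and n_pos: "\<And>j. j \<in> {1..s} \<Longrightarrow> 1 \<le> n j"
    and n_mono: "\<And>j k. 1 \<le> j \<Longrightarrow> j \<le> k \<Longrightarrow> k \<le> s \<Longrightarrow> n j \<le> n k"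
    and d_pos: "\<And>i j. i \<in> {1..r} \<Longrightarrow> j \<in> {1..s} \<Longrightarrow> 1 \<le> d i j"
    and f: "f \<in> carrier (C_ring s n r d)"
  shows "(f \<in> inertia_forms s n r d \<longleftrightarrow>
            (\<exists>\<nu>::nat. \<forall>\<iota>\<in>index_tuples s n. sigma s \<iota> ^ \<nu> * f \<in> generic_ideal s n r d))
       \<and> ((\<exists>\<nu>::nat. \<forall>\<iota>\<in>index_tuples s n. sigma s \<iota> ^ \<nu> * f \<in> generic_ideal s n r d) \<longleftrightarrow>
            (\<exists>\<nu>::nat. \<exists>\<iota>\<in>index_tuples s n. sigma s \<iota> ^ \<nu> * f \<in> generic_ideal s n r d))
       \<and> ((\<exists>\<nu>::nat. \<exists>\<iota>\<in>index_tuples s n. sigma s \<iota> ^ \<nu> * f \<in> generic_ideal s n r d) \<longleftrightarrow>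
            (\<exists>\<nu>::nat \<Rightarrow> nat. \<forall>\<alpha>\<in>exponents s n \<nu>. xmonom \<alpha> * f \<in> generic_ideal s n r d))"
    (is "(?one \<longleftrightarrow> ?two) \<and> (?two \<longleftrightarrow> ?three) \<and> (?three \<longleftrightarrow> ?four)")
proof -
  let ?I = "generic_ideal s n r d :: 'k cpoly set"
  \<comment> \<open>The property about monomials of a multidegree supplies no index tuple; this one will do.\<close>
  define \<iota>\<^sub>1 where "\<iota>\<^sub>1 = restrict (\<lambda>_. 1::nat) {1..s}"
  have \<iota>\<^sub>1: "\<iota>\<^sub>1 \<in> index_tuples s n" by (auto simp: \<iota>\<^sub>1_def index_tuples_def)
  have uniform: ?two if loc: "\<forall>\<iota>\<in>index_tuples s n. \<exists>N. sigma s \<iota> ^ N * f \<in> ?I"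
  proof -
    obtain N where N: "\<And>\<iota>. \<iota> \<in> index_tuples s n \<Longrightarrow> sigma s \<iota> ^ N \<iota> * f \<in> ?I"
      using loc by metis
    define M where "M = (\<Sum>\<iota>\<in>index_tuples s n. N \<iota>)"
    have "sigma s \<iota> ^ M * f \<in> ?I" if \<iota>: "\<iota> \<in> index_tuples s n" for \<iota>
    proof -
      have "N \<iota> \<le> M" unfolding M_def by (rule member_le_sum) (use \<iota> finite_index_tuples in auto)
      hence *: "sigma s \<iota> ^ M * f = sigma s \<iota> ^ (M - N \<iota>) * (sigma s \<iota> ^ N \<iota> * f)"
        by (simp add: mult.assoc[symmetric] flip: power_add)
      show ?thesis unfolding * by (rule generic_ideal_closed(4)[OF sigma_power_in_C[OF \<iota>] N[OF \<iota>]])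
    qed
    thus ?thesis by blast
  qed
  have one_two: "?one \<longleftrightarrow> ?two"
    unfolding inertia_forms_iff[OF f] using uniform by blast
  moreover have "?two \<Longrightarrow> ?four"
  proof -
    assume ?two
    then obtain N where N: "\<And>\<iota>. \<iota> \<in> index_tuples s n \<Longrightarrow> sigma s \<iota> ^ N * f \<in> ?I" by blast
    have "xmonom \<alpha> * f \<in> ?I" if "\<alpha> \<in> exponents s n (\<lambda>j. (n j + 1) * N)" for \<alpha>
    proof -
      obtain \<iota> \<beta> where \<iota>: "\<iota> \<in> index_tuples s n" and \<beta>: "\<beta> \<in> monomials (xvars s n)"
        and \<alpha>: "\<alpha> = \<beta> + corner s \<iota> (\<lambda>_. N)"
        using exponent_divisible_by_corner[OF \<open>\<alpha> \<in> _\<close>] .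
      have *: "xmonom \<alpha> * f = xmonom \<beta> * (sigma s \<iota> ^ N * f)"
        by (simp add: \<alpha> xmonom_add sigma_power_eq mult.assoc)
      show ?thesis unfolding * by (rule generic_ideal_closed(4)[OF xmonom_in_C[OF \<beta>] N[OF \<iota>]])
    qed
    thus ?four by blast
  qed
  moreover have "?four \<Longrightarrow> ?three"
  proof -
    assume ?four
    then obtain \<nu> where \<nu>: "\<And>\<alpha>. \<alpha> \<in> exponents s n \<nu> \<Longrightarrow> xmonom \<alpha> * f \<in> ?I" by blast
    define N where "N = (\<Sum>j = 1..s. \<nu> j)"
    define \<beta> where "\<beta> = corner s \<iota>\<^sub>1 (\<lambda>j. N - \<nu> j)"
    have "corner s \<iota>\<^sub>1 (\<lambda>_. N) = \<beta> + corner s \<iota>\<^sub>1 \<nu>"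
      unfolding \<beta>_def by (rule corner_split) (auto simp: N_def intro!: member_le_sum)
    hence *: "sigma s \<iota>\<^sub>1 ^ N * f = xmonom \<beta> * (xmonom (corner s \<iota>\<^sub>1 \<nu>) * f)"
      by (simp add: sigma_power_eq xmonom_add mult.assoc)
    have \<beta>: "\<beta> \<in> monomials (xvars s n)"
      unfolding \<beta>_def by (rule subsetD[OF exponents_subset_monomials corner_in_exponents[OF \<iota>\<^sub>1]])
    have "sigma s \<iota>\<^sub>1 ^ N * f \<in> ?I"
      unfolding * by (rule generic_ideal_closed(4)[OF xmonom_in_C[OF \<beta>] \<nu>[OF corner_in_exponents[OF \<iota>\<^sub>1]]])
    thus ?three using \<iota>\<^sub>1 by blast
  qed
  moreover have "?three \<Longrightarrow> ?two"
  proof (rule uniform, rule ballI)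
    fix \<iota> assume three: ?three and \<iota>: "\<iota> \<in> index_tuples s n"
    obtain N \<kappa> where "sigma s \<kappa> ^ N * f \<in> ?I" using three by blast
    thus "\<exists>N. sigma s \<iota> ^ N * f \<in> ?I"
      unfolding sigma_power_eq[of s \<kappa>] by (rule sigma_power_torsion_of_monomial_torsion[OF \<iota> f])
  qed
  moreover have "?two \<Longrightarrow> ?three" using \<iota>\<^sub>1 by blast
  ultimately show ?thesis by blast
qed

end
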